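(* Let $b\ge1$ be an integer, $q\in[0,1)$, $\{p_k\}_{k\ge0}$ a probability distribution with mean $E(Z)=\sum_kkp_k\in(0,\infty)$ and $\sum_kk^2p_k<\infty$, and $H_1,\dots,H_b$ mutually disjoint sets with $\bigcup_iH_i=\{0,1,2,\dots\}$ and $\sum_{k\in H_i}kp_k=E(Z)/b$ for all $i$. Put $u_i=\sum_{x\in H_i}x^2p_x$ and let $\pi$ be a permutation of $\{1,\dots,b\}$ such that $u_{\pi(1)}\ge u_{\pi(2)}\ge\dots\ge u_{\pi(b)}$. (i) If the permutation $h$ is chosen with $h(\pi(i))=\pi(i)$ for all $i$, then the generalized configuration model constructed with $h$ is assortative mixing, i.e. $E(XY)-E(X)E(Y)\ge0$. (ii) If the permutation $h$ is chosen with $h(\pi(i))=\pi(b+1-i)$ for all $i$, then the generalized configuration model constructed with $h$ is disassortative mixing, i.e. $E(XY)-E(X)E(Y)\le0$. Here $X,Y$ are the degrees of the two end vertices of a random edge, with joint probability mass function (determined by $h$) $$\Pr(X=x,Y=y)=C_{ij}\frac{xy\,p_xp_y}{(E(Z))^2}\quad (x\in H_i,\ y\in H_j),\qquad C_{ij}=\begin{cases}bq+1-q,&h(i)=j\\1-q,&h(i)\neq j.\end{cases}$$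
   Context: The generalized configuration model: stubs (half-edges) of a degree sequence following $\{p_k\}$ are sorted by vertex degree and divided into $b$ equal blocks, block $i$ being the stubs of vertices with degree in $H_i$; a fraction $q$ of randomly chosen stubs in each block is of type 1, the rest of type 2; type 1 stubs of block $i$ are randomly matched with type 1 stubs of block $h(i)$, and type 2 stubs are randomly matched with type 2 stubs of all blocks. In the large-network limit the end degrees of a random edge have the joint probability mass function given in the claim. Assortative (resp. disassortative) mixing means that the numerator $E(XY)-E(X)E(Y)$ of the Pearson degree correlation coefficient of $X$ and $Y$ is non-negative (resp. non-positive). *)

theory Defs
  imports "HOL-Probability.Probability"
begin

definition degree_block :: "nat \<Rightarrow> (nat \<Rightarrow> nat set) \<Rightarrow> nat \<Rightarrow> nat" where
  "degree_block b H x = (THE i. i \<in> {1..b} \<and> x \<in> H i)"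

definition block_coeff :: "nat \<Rightarrow> real \<Rightarrow> (nat \<Rightarrow> nat) \<Rightarrow> nat \<Rightarrow> nat \<Rightarrow> real" where
  "block_coeff b q h i j = (if h i = j then real b * q + 1 - q else 1 - q)"

definition mean_degree :: "nat pmf \<Rightarrow> real" where
  "mean_degree p = measure_pmf.expectation p real"

definition gcm_mass ::
  "nat \<Rightarrow> real \<Rightarrow> nat pmf \<Rightarrow> (nat \<Rightarrow> nat set) \<Rightarrow> (nat \<Rightarrow> nat) \<Rightarrow> nat \<times> nat \<Rightarrow> real" where
  "gcm_mass b q p H h = (\<lambda>(x, y).
     block_coeff b q h (degree_block b H x) (degree_block b H y) *
       (real x * real y * pmf p x * pmf p y / (mean_degree p)\<^sup>2))"

text \<open>
  Large-network limit law of the pair of end degrees of a random edge. The value of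
  \<open>embed_pmf\<close> is meaningful only for a genuine probability mass function; see
  \<open>pmf_gcm_edge_pmf\<close> below.
\<close>

definition gcm_edge_pmf ::
  "nat \<Rightarrow> real \<Rightarrow> nat pmf \<Rightarrow> (nat \<Rightarrow> nat set) \<Rightarrow> (nat \<Rightarrow> nat) \<Rightarrow> (nat \<times> nat) pmf" where
  "gcm_edge_pmf b q p H h = embed_pmf (gcm_mass b q p H h)"

text \<open>
  The numerator \<open>E(XY) - E(X) E(Y)\<close> of the Pearson correlation coefficient, where \<open>(X, Y)\<close>
  has law \<open>J\<close>. The expectations are Bochner integrals, so integrability matters; for
  \<open>gcm_edge_pmf\<close> it is \<open>integrable_gcm_edge_pmf\<close> below.
\<close>

definition degree_correlation_numerator :: "(nat \<times> nat) pmf \<Rightarrow> real" where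
  "degree_correlation_numerator J =
     measure_pmf.expectation J (\<lambda>(x, y). real x * real y)
     - measure_pmf.expectation J (\<lambda>(x, y). real x) * measure_pmf.expectation J (\<lambda>(x, y). real y)"

definition assortative_mixing :: "(nat \<times> nat) pmf \<Rightarrow> bool" where
  "assortative_mixing J \<longleftrightarrow> degree_correlation_numerator J \<ge> 0"

definition disassortative_mixing :: "(nat \<times> nat) pmf \<Rightarrow> bool" where
  "disassortative_mixing J \<longleftrightarrow> degree_correlation_numerator J \<le> 0"

definition block_second_moment :: "nat pmf \<Rightarrow> (nat \<Rightarrow> nat set) \<Rightarrow> nat \<Rightarrow> real" where
  "block_second_moment p H i = (\<Sum>\<^sub>\<infinity>x\<in>H i. (real x)\<^sup>2 * pmf p x)"

lemma degree_block_eq: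
  assumes "disjoint_family_on H {1..b}" and "i \<in> {1..b}" and "x \<in> H i"
  shows "degree_block b H x = i"
  unfolding degree_block_def
proof (rule the_equality)
  show "i \<in> {1..b} \<and> x \<in> H i" using assms by blast
next
  fix j assume "j \<in> {1..b} \<and> x \<in> H j"
  then show "j = i" using assms unfolding disjoint_family_on_def by blast
qed

lemma integrable_pmf_summable_on:
  fixes g :: "nat \<Rightarrow> real"
  assumes "integrable (measure_pmf p) g"
  shows "Infinite_Set_Sum.abs_summable_on (\<lambda>x. g x * pmf p x) A"
proof -
  have "integrable (density (count_space UNIV) (\<lambda>x. ennreal (pmf p x))) g"
    using assms by (simp add: measure_pmf_eq_density)
  then have "integrable (count_space UNIV) (\<lambda>x. g x * pmf p x)"
    by (subst (asm) integrable_density) (auto simp: mult.commute)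
  then have "Infinite_Set_Sum.abs_summable_on (\<lambda>x. g x * pmf p x) UNIV"
    unfolding Infinite_Set_Sum.abs_summable_on_def .
  then show ?thesis
    by (rule abs_summable_on_subset) simp
qed

lemma nn_integral_block_product:
  fixes f g :: "nat \<Rightarrow> ennreal" and c :: "nat \<Rightarrow> nat \<Rightarrow> real"
  assumes disj: "disjoint_family_on H {1..b}" and cover: "(\<Union>i\<in>{1..b}. H i) = UNIV"
  shows "(\<integral>\<^sup>+z. (case z of (x, y) \<Rightarrow>
            ennreal (c (degree_block b H x) (degree_block b H y)) * (f x * g y)) \<partial>count_space UNIV)
         = (\<Sum>i\<in>{1..b}. \<Sum>j\<in>{1..b}. ennreal (c i j) *
             ((\<integral>\<^sup>+x. f x * indicator (H i) x \<partial>count_space UNIV) *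
              (\<integral>\<^sup>+y. g y * indicator (H j) y \<partial>count_space UNIV)))"
proof -
  have pt: "ennreal (c (degree_block b H x) (degree_block b H y)) * (f x * g y) =
      (\<Sum>i\<in>{1..b}. \<Sum>j\<in>{1..b}. ennreal (c i j) *
        ((f x * indicator (H i) x) * (g y * indicator (H j) y)))" for x y
  proof -
    obtain k where k: "k \<in> {1..b}" "x \<in> H k" using cover by blast
    obtain l where l: "l \<in> {1..b}" "y \<in> H l" using cover by blast
    have ik: "indicator (H i) x = (if i = k then 1 else 0 :: ennreal)" if "i \<in> {1..b}" for i
    proof (cases "i = k")
      case False
      then have "x \<notin> H i"
        using degree_block_eq[OF disj k] degree_block_eq[OF disj that] by blast
      then show ?thesis using False by simp
    qed (use k in simp)
    have il: "indicator (H i) y = (if i = l then 1 else 0 :: ennreal)" if "i \<in> {1..b}" for i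
    proof (cases "i = l")
      case False
      then have "y \<notin> H i"
        using degree_block_eq[OF disj l] degree_block_eq[OF disj that] by blast
      then show ?thesis using False by simp
    qed (use l in simp)
    have "(\<Sum>i\<in>{1..b}. \<Sum>j\<in>{1..b}. ennreal (c i j) *
        ((f x * indicator (H i) x) * (g y * indicator (H j) y)))
      = (\<Sum>i\<in>{1..b}. \<Sum>j\<in>{1..b}. if j = l then
           (if i = k then ennreal (c k l) * (f x * g y) else 0) else 0)"
      by (intro sum.cong refl) (auto simp: ik il)
    also have "\<dots> = ennreal (c k l) * (f x * g y)"
      using k l by (simp add: sum.delta)
    finally show ?thesis
      using degree_block_eq[OF disj k] degree_block_eq[OF disj l] by simp
  qed
  have "(\<integral>\<^sup>+z. (case z of (x, y) \<Rightarrow>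
            ennreal (c (degree_block b H x) (degree_block b H y)) * (f x * g y)) \<partial>count_space UNIV)
     = (\<integral>\<^sup>+x. \<integral>\<^sup>+y. (\<Sum>i\<in>{1..b}. \<Sum>j\<in>{1..b}. ennreal (c i j) *
        ((f x * indicator (H i) x) * (g y * indicator (H j) y))) \<partial>count_space UNIV \<partial>count_space UNIV)"
    by (subst nn_integral_fst_count_space[symmetric]) (simp only: prod.case pt)
  then show ?thesis
    by (simp add: nn_integral_sum nn_integral_cmult nn_integral_multc)
qed

context
  fixes b :: nat and q :: real and p :: "nat pmf"
    and H :: "nat \<Rightarrow> nat set" and h :: "nat \<Rightarrow> nat"
  assumes b: "b \<ge> 1" and q: "0 \<le> q" "q < 1"
    and second_moment: "integrable (measure_pmf p) (\<lambda>k. (real k)\<^sup>2)"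
    and mean: "integrable (measure_pmf p) real" "mean_degree p > 0"
    and disj: "disjoint_family_on H {1..b}" and cover: "(\<Union>i\<in>{1..b}. H i) = UNIV"
    and blocks: "\<And>i. i \<in> {1..b} \<Longrightarrow> (\<Sum>\<^sub>\<infinity>k\<in>H i. real k * pmf p k) = mean_degree p / real b"
    and h: "h permutes {1..b}"
begin

lemma block_coeff_nonneg: "block_coeff b q h i j \<ge> 0"
proof -
  have "real b * q \<ge> 0" using q by simp
  then have "real b * q + 1 - q \<ge> 0" using q by linarith
  then show ?thesis using q by (simp add: block_coeff_def)
qed

lemma gcm_mass_nonneg: "gcm_mass b q p H h z \<ge> 0"
  by (cases z) (auto simp: gcm_mass_def block_coeff_nonneg)

lemma ennreal_gcm_mass:
  "ennreal (gcm_mass b q p H h (x, y)) =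
     ennreal (block_coeff b q h (degree_block b H x) (degree_block b H y) / (mean_degree p)\<^sup>2) *
       (ennreal (real x * pmf p x) * ennreal (real y * pmf p y))"
  by (simp add: gcm_mass_def block_coeff_nonneg ennreal_mult[symmetric] mult_ac)

lemma nn_integral_block:
  assumes "i \<in> {1..b}"
  shows "(\<integral>\<^sup>+x. ennreal (real x * pmf p x) * indicator (H i) x \<partial>count_space UNIV)
         = ennreal (mean_degree p / real b)"
proof -
  have s: "Infinite_Set_Sum.abs_summable_on (\<lambda>x. real x * pmf p x) (H i)"
    by (rule integrable_pmf_summable_on[OF mean(1)])
  have "(\<integral>\<^sup>+x. ennreal (real x * pmf p x) * indicator (H i) x \<partial>count_space UNIV)
        = (\<integral>\<^sup>+x. ennreal (real x * pmf p x) \<partial>count_space (H i))"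
    by (simp add: nn_integral_count_space_indicator)
  also have "\<dots> = ennreal (infsetsum (\<lambda>x. real x * pmf p x) (H i))"
    by (rule nn_integral_conv_infsetsum) (use s in auto)
  also have "infsetsum (\<lambda>x. real x * pmf p x) (H i) = mean_degree p / real b"
    using blocks[OF assms] s by (simp add: infsetsum_infsum)
  finally show ?thesis .
qed

lemma sum_block_coeff:
  assumes "i \<in> {1..b}"
  shows "(\<Sum>j\<in>{1..b}. block_coeff b q h i j) = real b"
proof -
  have "h i \<in> {1..b}" using permutes_in_image[OF h] assms by blast
  moreover have "block_coeff b q h i j = (if h i = j then real b * q else 0) + (1 - q)" for j
    by (simp add: block_coeff_def)
  ultimately have "(\<Sum>j\<in>{1..b}. block_coeff b q h i j) = real b * q + real b * (1 - q)"
    by (simp add: sum.distrib del: One_nat_def)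
  then show ?thesis by (simp add: algebra_simps)
qed

lemma nn_integral_gcm_mass: "(\<integral>\<^sup>+z. ennreal (gcm_mass b q p H h z) \<partial>count_space UNIV) = 1"
proof -
  let ?m = "mean_degree p"
  have "(\<integral>\<^sup>+z. ennreal (gcm_mass b q p H h z) \<partial>count_space UNIV)
    = (\<integral>\<^sup>+z. (case z of (x, y) \<Rightarrow>
        ennreal (block_coeff b q h (degree_block b H x) (degree_block b H y) / ?m\<^sup>2) *
          (ennreal (real x * pmf p x) * ennreal (real y * pmf p y))) \<partial>count_space UNIV)"
    by (intro nn_integral_cong) (auto simp: ennreal_gcm_mass split: prod.split)
  also have "\<dots> = (\<Sum>i\<in>{1..b}. \<Sum>j\<in>{1..b}. ennreal (block_coeff b q h i j / ?m\<^sup>2) *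
      (ennreal (?m / real b) * ennreal (?m / real b)))"
    by (subst nn_integral_block_product[OF disj cover,
          where c = "\<lambda>i j. block_coeff b q h i j / ?m\<^sup>2"])
       (intro sum.cong refl, simp only: nn_integral_block)
  also have "\<dots> = (\<Sum>i\<in>{1..b}. \<Sum>j\<in>{1..b}. ennreal (block_coeff b q h i j / (real b)\<^sup>2))"
    using mean(2) b
    by (intro sum.cong refl)
       (simp add: ennreal_mult[symmetric] block_coeff_nonneg power2_eq_square)
  also have "\<dots> = ennreal (\<Sum>i\<in>{1..b}. \<Sum>j\<in>{1..b}. block_coeff b q h i j / (real b)\<^sup>2)"
    by (simp add: sum_ennreal block_coeff_nonneg sum_nonneg)
  also have "(\<Sum>i\<in>{1..b}. \<Sum>j\<in>{1..b}. block_coeff b q h i j / (real b)\<^sup>2)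
    = (\<Sum>i\<in>{1..b}. real b / (real b)\<^sup>2)"
    by (intro sum.cong refl) (simp only: sum_divide_distrib[symmetric] sum_block_coeff)
  also have "\<dots> = 1"
    using b by (simp add: power2_eq_square)
  finally show ?thesis by simp
qed

lemma pmf_gcm_edge_pmf_eq_mass: "pmf (gcm_edge_pmf b q p H h) z = gcm_mass b q p H h z"
  unfolding gcm_edge_pmf_def
  by (rule pmf_embed_pmf) (auto simp: gcm_mass_nonneg nn_integral_gcm_mass)

lemma pmf_gcm_edge_pmf:
  assumes "i \<in> {1..b}" "j \<in> {1..b}" "x \<in> H i" "y \<in> H j"
  shows "pmf (gcm_edge_pmf b q p H h) (x, y) =
    block_coeff b q h i j * (real x * real y * pmf p x * pmf p y / (mean_degree p)\<^sup>2)"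
  using degree_block_eq[OF disj assms(1,3)] degree_block_eq[OF disj assms(2,4)]
  by (simp add: pmf_gcm_edge_pmf_eq_mass gcm_mass_def)

lemma integrable_gcm_edge_pmf:
  "integrable (measure_pmf (gcm_edge_pmf b q p H h)) (\<lambda>(x, y). real x * real y)"
  "integrable (measure_pmf (gcm_edge_pmf b q p H h)) (\<lambda>(x, y). real x)"
  "integrable (measure_pmf (gcm_edge_pmf b q p H h)) (\<lambda>(x, y). real y)"
proof -
  let ?J = "measure_pmf (gcm_edge_pmf b q p H h)"
  let ?m = "mean_degree p"
  let ?F = "\<lambda>i. \<integral>\<^sup>+x. ennreal ((real x)\<^sup>2 * pmf p x) * indicator (H i) x \<partial>count_space UNIV"
  have fin: "?F i < \<infinity>" for i
  proof -
    have "?F i \<le> (\<integral>\<^sup>+x. ennreal (pmf p x) * ennreal ((real x)\<^sup>2) \<partial>count_space UNIV)"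
      by (intro nn_integral_mono) (auto simp: indicator_def ennreal_mult[symmetric] mult_ac)
    also have "\<dots> = (\<integral>\<^sup>+x. ennreal ((real x)\<^sup>2) \<partial>measure_pmf p)"
      by (simp add: nn_integral_measure_pmf)
    also have "\<dots> < \<infinity>"
      using second_moment by (simp add: integrable_iff_bounded)
    finally show ?thesis .
  qed
  have "(\<integral>\<^sup>+z. ennreal (norm (case z of (x, y) \<Rightarrow> real x * real y)) \<partial>?J)
    = (\<integral>\<^sup>+z. (case z of (x, y) \<Rightarrow>
        ennreal (block_coeff b q h (degree_block b H x) (degree_block b H y) / ?m\<^sup>2) *
          (ennreal ((real x)\<^sup>2 * pmf p x) * ennreal ((real y)\<^sup>2 * pmf p y))) \<partial>count_space UNIV)"
    unfolding nn_integral_measure_pmf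
    by (intro nn_integral_cong)
       (auto simp: pmf_gcm_edge_pmf_eq_mass gcm_mass_def block_coeff_nonneg
          ennreal_mult[symmetric] power2_eq_square mult_ac split: prod.split)
  also have "\<dots> = (\<Sum>i\<in>{1..b}. \<Sum>j\<in>{1..b}. ennreal (block_coeff b q h i j / ?m\<^sup>2) * (?F i * ?F j))"
    by (rule nn_integral_block_product[OF disj cover,
          where c = "\<lambda>i j. block_coeff b q h i j / ?m\<^sup>2"])
  also have "\<dots> < \<infinity>"
    using fin by (auto simp: ennreal_mult_less_top)
  finally show xy: "integrable ?J (\<lambda>(x, y). real x * real y)"
    by (intro integrableI_bounded) auto
  have pos: "x > 0 \<and> y > 0" if "(x, y) \<in> set_pmf (gcm_edge_pmf b q p H h)" for x y
    using that by (auto simp: set_pmf_iff pmf_gcm_edge_pmf_eq_mass gcm_mass_def intro!: gr0I)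
  have le: "real x \<le> real x * real y" "real y \<le> real x * real y"
    if "(x, y) \<in> set_pmf (gcm_edge_pmf b q p H h)" for x y
    using pos[OF that] by auto
  show "integrable ?J (\<lambda>(x, y). real x)"
    by (rule Bochner_Integration.integrable_bound[OF xy]) (auto simp: AE_measure_pmf_iff le)
  show "integrable ?J (\<lambda>(x, y). real y)"
    by (rule Bochner_Integration.integrable_bound[OF xy]) (auto simp: AE_measure_pmf_iff le)
qed

end

end

theory Submission
  imports Defs
begin

text \<open>
  With \<open>m = E(Z)\<close>, splitting the law of \<open>(X, Y)\<close> into blocks gives
  \<open>E(X) = E(Y) = (\<Sum>i. u i) / m\<close> for every permutation \<open>h\<close> and
  \<open>E(XY) - E(X) E(Y) = q / m\<^sup>2 * (b * (\<Sum>i. u i * u (h i)) - (\<Sum>i. u i)\<^sup>2)\<close>.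
  Chebyshev's sum inequality then gives the sign, according to whether \<open>h\<close> pairs the \<open>u i\<close>
  in equal or in opposite order.
\<close>

text \<open>Expanding the product, the two diagonal terms each contribute the sum of
  \<open>f i * g i\<close> once per index, and the two mixed terms factor. The sign of the
  right-hand side can thus be read off from single summands on the left, with no induction on a
  sorted sequence.\<close>

lemma Chebyshev_sum_identity:
  fixes f g :: "'a \<Rightarrow> real"
  shows "(\<Sum>i\<in>A. \<Sum>j\<in>A. (f i - f j) * (g i - g j))
    = 2 * (real (card A) * (\<Sum>i\<in>A. f i * g i) - sum f A * sum g A)"
proof -
  have 1: "(\<Sum>i\<in>A. \<Sum>j\<in>A. f i * g j) = sum f A * sum g A"
    by (rule sum_product[symmetric])
  have 2: "(\<Sum>i\<in>A. \<Sum>j\<in>A. f j * g i) = sum f A * sum g A"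
    by (subst sum.swap) (rule 1)
  have 3: "(\<Sum>i\<in>A. \<Sum>j\<in>A. f i * g i) = real (card A) * (\<Sum>i\<in>A. f i * g i)"
    by (simp add: sum_distrib_left)
  have 4: "(\<Sum>i\<in>A. \<Sum>j\<in>A. f j * g j) = real (card A) * (\<Sum>i\<in>A. f i * g i)"
    by simp
  have "(f i - f j) * (g i - g j) = f i * g i + f j * g j - f i * g j - f j * g i" for i j
    by (simp add: algebra_simps)
  then show ?thesis
    by (simp only: sum.distrib sum_subtractf 1 2 3 4) simp
qed

text \<open>As a matrix, \<open>block_coeff\<close> is the constant \<open>1 - q\<close> plus
  \<open>real b * q\<close> times the permutation matrix of \<open>h\<close>. The first part factors
  into a product of sums, the second selects \<open>j = h i\<close>.\<close>

lemma sum_block_coeff_bilinear: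
  assumes "h permutes {1..b}"
  shows "(\<Sum>i\<in>{1..b}. \<Sum>j\<in>{1..b}. block_coeff b q h i j * (\<phi> i * \<psi> j))
    = real b * q * (\<Sum>i\<in>{1..b}. \<phi> i * \<psi> (h i)) + (1 - q) * (sum \<phi> {1..b} * sum \<psi> {1..b})"
proof -
  have inner: "(\<Sum>j\<in>{1..b}. block_coeff b q h i j * (\<phi> i * \<psi> j))
      = real b * q * (\<phi> i * \<psi> (h i)) + (1 - q) * (\<phi> i * sum \<psi> {1..b})" if "i \<in> {1..b}" for i
  proof -
    have "h i \<in> {1..b}" using permutes_in_image[OF assms] that by blast
    moreover have "block_coeff b q h i j * (\<phi> i * \<psi> j)
        = (if h i = j then real b * q * (\<phi> i * \<psi> j) else 0) + (1 - q) * (\<phi> i * \<psi> j)" for j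
      by (simp add: block_coeff_def algebra_simps)
    ultimately show ?thesis
      by (simp add: sum.distrib sum_distrib_left del: One_nat_def)
  qed
  have "(\<Sum>i\<in>{1..b}. \<Sum>j\<in>{1..b}. block_coeff b q h i j * (\<phi> i * \<psi> j))
      = (\<Sum>i\<in>{1..b}. real b * q * (\<phi> i * \<psi> (h i)) + (1 - q) * (\<phi> i * sum \<psi> {1..b}))"
    by (rule sum.cong[OF refl inner])
  then show ?thesis
    by (simp only: sum.distrib sum_distrib_left[symmetric] sum_distrib_right[symmetric])
qed

context
  fixes b :: nat and q :: real and p :: "nat pmf"
    and H :: "nat \<Rightarrow> nat set" and h :: "nat \<Rightarrow> nat"
  assumes b: "b \<ge> 1" and q: "0 \<le> q" "q < 1"
    and second_moment: "integrable (measure_pmf p) (\<lambda>k. (real k)\<^sup>2)"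
    and mean: "integrable (measure_pmf p) real" "mean_degree p > 0"
    and disj: "disjoint_family_on H {1..b}" and cover: "(\<Union>i\<in>{1..b}. H i) = UNIV"
    and blocks: "\<And>i. i \<in> {1..b} \<Longrightarrow> (\<Sum>\<^sub>\<infinity>k\<in>H i. real k * pmf p k) = mean_degree p / real b"
    and h: "h permutes {1..b}"
begin

text \<open>On each rectangle \<open>H i\<close> times \<open>H j\<close> the mass is a constant
  times a product, so the expectation reduces to block sums; the extra factor \<open>real x\<close>
  is the size bias of an edge end. Taking \<open>f\<close> and \<open>g\<close> to be
  \<open>real\<close> or 1 yields E(XY), E(X) and E(Y).\<close>

lemma expectation_gcm_edge_pmf_product:
  assumes f: "\<And>x. f x \<ge> 0" "integrable (measure_pmf p) (\<lambda>x. f x * real x)"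
    and g: "\<And>x. g x \<ge> 0" "integrable (measure_pmf p) (\<lambda>x. g x * real x)"
    and \<phi>: "\<And>i. i \<in> {1..b} \<Longrightarrow> (\<Sum>\<^sub>\<infinity>x\<in>H i. f x * real x * pmf p x) = \<phi> i"
    and \<psi>: "\<And>i. i \<in> {1..b} \<Longrightarrow> (\<Sum>\<^sub>\<infinity>x\<in>H i. g x * real x * pmf p x) = \<psi> i"
  shows "measure_pmf.expectation (gcm_edge_pmf b q p H h) (\<lambda>(x, y). f x * g y)
    = (real b * q * (\<Sum>i\<in>{1..b}. \<phi> i * \<psi> (h i)) + (1 - q) * (sum \<phi> {1..b} * sum \<psi> {1..b}))
      / (mean_degree p)\<^sup>2"
proof -
  let ?J = "gcm_edge_pmf b q p H h" and ?m = "mean_degree p"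
  note ctx = b q second_moment mean disj cover blocks h
  have c_nonneg: "block_coeff b q h i j \<ge> 0" for i j
    by (rule block_coeff_nonneg) (use ctx in auto)
  have mass: "pmf ?J z = gcm_mass b q p H h z" for z
    by (rule pmf_gcm_edge_pmf_eq_mass) (use ctx in auto)
  \<comment> \<open>Absolute summability is essential here: the infinite sum of a non-summable
    family defaults to 0.\<close>
  have block: "(\<integral>\<^sup>+x. ennreal (k x * real x * pmf p x) * indicator (H i) x \<partial>count_space UNIV)
      = ennreal (\<Sum>\<^sub>\<infinity>x\<in>H i. k x * real x * pmf p x)"
    if k: "\<And>x. k x \<ge> 0" "integrable (measure_pmf p) (\<lambda>x. k x * real x)" for k i
  proof -
    have s: "Infinite_Set_Sum.abs_summable_on (\<lambda>x. k x * real x * pmf p x) (H i)"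
      by (rule integrable_pmf_summable_on[OF k(2)])
    have "(\<integral>\<^sup>+x. ennreal (k x * real x * pmf p x) * indicator (H i) x \<partial>count_space UNIV)
        = (\<integral>\<^sup>+x. ennreal (k x * real x * pmf p x) \<partial>count_space (H i))"
      by (simp add: nn_integral_count_space_indicator)
    also have "\<dots> = ennreal (infsetsum (\<lambda>x. k x * real x * pmf p x) (H i))"
      by (rule nn_integral_conv_infsetsum) (use s k in auto)
    finally show ?thesis using s by (simp add: infsetsum_infsum)
  qed
  \<comment> \<open>\<open>ennreal\<close> truncates negative reals to 0, so products and sums merge
    under it only once these signs are known.\<close>
  have nonneg: "\<phi> i \<ge> 0" "\<psi> i \<ge> 0" if "i \<in> {1..b}" for i
    using that f(1) g(1) by (auto simp flip: \<phi> \<psi> intro!: infsum_nonneg)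
  have summand_nonneg: "block_coeff b q h i j * (\<phi> i * \<psi> j) / ?m\<^sup>2 \<ge> 0"
    if "i \<in> {1..b}" "j \<in> {1..b}" for i j
    using c_nonneg nonneg that by simp
  let ?S = "\<Sum>i\<in>{1..b}. \<Sum>j\<in>{1..b}. block_coeff b q h i j * (\<phi> i * \<psi> j) / ?m\<^sup>2"
  have "(\<integral>\<^sup>+z. ennreal (case z of (x, y) \<Rightarrow> f x * g y) \<partial>?J)
    = (\<integral>\<^sup>+z. (case z of (x, y) \<Rightarrow>
        ennreal (block_coeff b q h (degree_block b H x) (degree_block b H y) / ?m\<^sup>2) *
          (ennreal (f x * real x * pmf p x) * ennreal (g y * real y * pmf p y))) \<partial>count_space UNIV)"
    unfolding nn_integral_measure_pmf
    by (intro nn_integral_cong)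
       (auto simp: mass gcm_mass_def c_nonneg f g
          ennreal_mult[symmetric] mult_ac split: prod.split)
  also have "\<dots> = (\<Sum>i\<in>{1..b}. \<Sum>j\<in>{1..b}. ennreal (block_coeff b q h i j / ?m\<^sup>2) *
      (ennreal (\<phi> i) * ennreal (\<psi> j)))"
    by (subst nn_integral_block_product[OF disj cover,
          where c = "\<lambda>i j. block_coeff b q h i j / ?m\<^sup>2"])
       (intro sum.cong refl, simp only: block[OF f] block[OF g] \<phi> \<psi>)
  also have "\<dots> = (\<Sum>i\<in>{1..b}. \<Sum>j\<in>{1..b}. ennreal (block_coeff b q h i j * (\<phi> i * \<psi> j) / ?m\<^sup>2))"
    by (intro sum.cong refl) (simp add: ennreal_mult[symmetric] c_nonneg nonneg)
  also have "\<dots> = (\<Sum>i\<in>{1..b}. ennreal (\<Sum>j\<in>{1..b}. block_coeff b q h i j * (\<phi> i * \<psi> j) / ?m\<^sup>2))"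
    by (intro sum.cong refl sum_ennreal summand_nonneg)
  also have "\<dots> = ennreal ?S"
    by (intro sum_ennreal sum_nonneg summand_nonneg)
  finally have "(\<integral>\<^sup>+z. ennreal (case z of (x, y) \<Rightarrow> f x * g y) \<partial>?J) = ennreal ?S" .
  moreover have "?S \<ge> 0"
    by (intro sum_nonneg summand_nonneg)
  ultimately have "measure_pmf.expectation ?J (\<lambda>(x, y). f x * g y) = ?S"
    by (subst integral_eq_nn_integral) (auto simp: f g)
  also have "\<dots> = (\<Sum>i\<in>{1..b}. \<Sum>j\<in>{1..b}. block_coeff b q h i j * (\<phi> i * \<psi> j)) / ?m\<^sup>2"
    by (simp only: sum_divide_distrib)
  finally show ?thesis
    by (simp only: sum_block_coeff_bilinear[OF h])
qed

lemma degree_correlation_numerator_gcm_edge_pmf: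
  defines "u \<equiv> block_second_moment p H"
  shows "degree_correlation_numerator (gcm_edge_pmf b q p H h)
    = q / (mean_degree p)\<^sup>2 * (real b * (\<Sum>i\<in>{1..b}. u i * u (h i)) - sum u {1..b} * sum u {1..b})"
proof -
  let ?J = "gcm_edge_pmf b q p H h" and ?m = "mean_degree p" and ?U = "sum u {1..b}"
  have u: "(\<Sum>\<^sub>\<infinity>x\<in>H i. real x * real x * pmf p x) = u i" for i
    by (simp add: u_def block_second_moment_def power2_eq_square)
  have m: "(\<Sum>\<^sub>\<infinity>x\<in>H i. 1 * real x * pmf p x) = ?m / real b" if "i \<in> {1..b}" for i
    using blocks[OF that] by simp
  have int: "integrable (measure_pmf p) (\<lambda>x. real x * real x)"
    "integrable (measure_pmf p) (\<lambda>x. 1 * real x)"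
    using second_moment mean by (simp_all add: power2_eq_square)
  \<comment> \<open>This is why E(Y) agrees with E(X) and does not depend on
    \<open>h\<close>.\<close>
  have perm: "(\<Sum>i\<in>{1..b}. u (h i)) = ?U"
    using sum.permute[OF h, of u] by (simp add: o_def)
  have XY: "measure_pmf.expectation ?J (\<lambda>(x, y). real x * real y)
      = (real b * q * (\<Sum>i\<in>{1..b}. u i * u (h i)) + (1 - q) * (?U * ?U)) / ?m\<^sup>2"
    by (rule expectation_gcm_edge_pmf_product) (use u int in auto)
  have "measure_pmf.expectation ?J (\<lambda>(x, y). real x * 1)
      = (real b * q * (\<Sum>i\<in>{1..b}. u i * (?m / real b))
          + (1 - q) * (?U * (\<Sum>i\<in>{1..b}. ?m / real b))) / ?m\<^sup>2"
    by (rule expectation_gcm_edge_pmf_product) (use u m int in auto)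
  \<comment> \<open>The \<open>b\<close> in \<open>real b * q\<close> cancels against the block mean
    \<open>?m / real b\<close>, and the \<open>b\<close> block means add up to \<open>?m\<close>;
    the weights \<open>q\<close> and \<open>1 - q\<close> then add up to 1.\<close>
  also have "\<dots> = ?U / ?m"
    unfolding sum_distrib_right[symmetric]
    using b mean(2) by (simp add: field_simps power2_eq_square)
  finally have X: "measure_pmf.expectation ?J (\<lambda>(x, y). real x) = ?U / ?m"
    by simp
  have "measure_pmf.expectation ?J (\<lambda>(x, y). 1 * real y)
      = (real b * q * (\<Sum>i\<in>{1..b}. ?m / real b * u (h i))
          + (1 - q) * ((\<Sum>i\<in>{1..b}. ?m / real b) * ?U)) / ?m\<^sup>2"
    by (rule expectation_gcm_edge_pmf_product) (use u m int in auto)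
  also have "\<dots> = ?U / ?m"
    unfolding sum_distrib_left[symmetric] perm
    using b mean(2) by (simp add: field_simps power2_eq_square)
  finally have Y: "measure_pmf.expectation ?J (\<lambda>(x, y). real y) = ?U / ?m"
    by simp
  show ?thesis
    unfolding degree_correlation_numerator_def XY X Y
    using mean(2) by (simp add: field_simps power2_eq_square)
qed

end

theorem corollary1:
  fixes b :: nat and q :: real and p :: "nat pmf"
    and H :: "nat \<Rightarrow> nat set" and \<pi> :: "nat \<Rightarrow> nat"
  assumes "b \<ge> 1" and "0 \<le> q" and "q < 1"
    and "integrable (measure_pmf p) real" and "mean_degree p > 0"
    and "integrable (measure_pmf p) (\<lambda>k. (real k)\<^sup>2)"
    and "disjoint_family_on H {1..b}" and "(\<Union>i\<in>{1..b}. H i) = UNIV"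
    and "\<And>i. i \<in> {1..b} \<Longrightarrow> (\<Sum>\<^sub>\<infinity>k\<in>H i. real k * pmf p k) = mean_degree p / real b"
    and "\<pi> permutes {1..b}"
    and "antimono_on {1..b} (\<lambda>i. block_second_moment p H (\<pi> i))"
  shows "(\<forall>h. h permutes {1..b} \<and> (\<forall>i\<in>{1..b}. h (\<pi> i) = \<pi> i)
            \<longrightarrow> assortative_mixing (gcm_edge_pmf b q p H h))
       \<and> (\<forall>h. h permutes {1..b} \<and> (\<forall>i\<in>{1..b}. h (\<pi> i) = \<pi> (b + 1 - i))
            \<longrightarrow> disassortative_mixing (gcm_edge_pmf b q p H h))"
proof (intro conjI allI impI; elim conjE)
  define v where "v i = block_second_moment p H (\<pi> i)" for i
  have v: "v j \<le> v i" if "i \<in> {1..b}" "j \<in> {1..b}" "i \<le> j" for i j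
    using assms(11) that unfolding v_def by (auto simp: monotone_on_def)
  \<comment> \<open>Reindexing by \<open>\<pi>\<close> replaces blocks by their ranks, on which
    \<open>h\<close> acts as \<open>\<sigma>\<close>. Only a bijection of \<open>{1..b}\<close> is
    asked of \<open>\<sigma>\<close>, since the reversal below does not fix points outside that set.
    The division by 2 undoes the double counting in \<open>Chebyshev_sum_identity\<close>.\<close>
  have numerator: "degree_correlation_numerator (gcm_edge_pmf b q p H h)
      = q / (mean_degree p)\<^sup>2 *
        ((\<Sum>i\<in>{1..b}. \<Sum>j\<in>{1..b}. (v i - v j) * (v (\<sigma> i) - v (\<sigma> j))) / 2)"
    if h: "h permutes {1..b}" and \<sigma>: "bij_betw \<sigma> {1..b} {1..b}"
      and h\<pi>: "\<And>i. i \<in> {1..b} \<Longrightarrow> h (\<pi> i) = \<pi> (\<sigma> i)" for h \<sigma>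
  proof -
    let ?u = "block_second_moment p H"
    have uh: "(\<Sum>i\<in>{1..b}. ?u i * ?u (h i)) = (\<Sum>i\<in>{1..b}. v i * v (\<sigma> i))"
      by (subst sum.permute[OF assms(10)]) (simp add: v_def h\<pi> del: One_nat_def)
    have u: "sum ?u {1..b} = sum v {1..b}"
      by (subst sum.permute[OF assms(10)]) (simp add: v_def)
    have \<sigma>_sum: "(\<Sum>i\<in>{1..b}. v (\<sigma> i)) = sum v {1..b}"
      by (rule sum.reindex_bij_betw[OF \<sigma>])
    have "degree_correlation_numerator (gcm_edge_pmf b q p H h) = q / (mean_degree p)\<^sup>2 *
        (real b * (\<Sum>i\<in>{1..b}. ?u i * ?u (h i)) - sum ?u {1..b} * sum ?u {1..b})"
      using degree_correlation_numerator_gcm_edge_pmf assms h by blast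
    then show ?thesis
      unfolding Chebyshev_sum_identity uh u \<sigma>_sum
      using assms(5) by (simp add: field_simps del: One_nat_def)
  qed
  have scale: "q / (mean_degree p)\<^sup>2 \<ge> 0"
    using assms(2) by simp
  {
    \<comment> \<open>Here \<open>\<sigma>\<close> is the identity, so every summand is a
      square.\<close>
    fix h assume "h permutes {1..b}" "\<forall>i\<in>{1..b}. h (\<pi> i) = \<pi> i"
    then have "degree_correlation_numerator (gcm_edge_pmf b q p H h)
      = q / (mean_degree p)\<^sup>2 * ((\<Sum>i\<in>{1..b}. \<Sum>j\<in>{1..b}. (v i - v j) * (v i - v j)) / 2)"
      using numerator[of h "\<lambda>i. i"] by (simp add: bij_betw_def)
    also have "\<dots> \<ge> 0"
      by (intro mult_nonneg_nonneg[OF scale] divide_nonneg_nonneg sum_nonneg) auto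
    finally show "assortative_mixing (gcm_edge_pmf b q p H h)"
      by (simp add: assortative_mixing_def)
  next
    fix h assume h: "h permutes {1..b}" "\<forall>i\<in>{1..b}. h (\<pi> i) = \<pi> (b + 1 - i)"
    \<comment> \<open>The reversal is its own inverse; on \<open>{1..b}\<close> the natural-number
      subtraction never truncates.\<close>
    have "bij_betw (\<lambda>i. b + 1 - i) {1..b} {1..b}"
      by (rule bij_betw_byWitness[where f' = "\<lambda>i. b + 1 - i"]) auto
    with h have "degree_correlation_numerator (gcm_edge_pmf b q p H h)
      = q / (mean_degree p)\<^sup>2 *
        ((\<Sum>i\<in>{1..b}. \<Sum>j\<in>{1..b}. (v i - v j) * (v (b + 1 - i) - v (b + 1 - j))) / 2)"
      using numerator[of h "\<lambda>i. b + 1 - i"] by blast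
    also have "\<dots> \<le> 0"
    proof (intro mult_nonneg_nonpos[OF scale] divide_nonpos_nonneg sum_nonpos)
      fix i j assume ij: "i \<in> {1..b}" "j \<in> {1..b}"
      show "(v i - v j) * (v (b + 1 - i) - v (b + 1 - j)) \<le> 0"
      \<comment> \<open>Reversal turns \<open>i \<le> j\<close> into
        \<open>b + 1 - j \<le> b + 1 - i\<close>, so by antitonicity of \<open>v\<close> the two
        factors have opposite signs in either case.\<close>
      proof (cases "i \<le> j")
        case True
        then show ?thesis
          using ij v[of i j] v[of "b + 1 - j" "b + 1 - i"] by (intro mult_nonneg_nonpos) auto
      next
        case False
        then show ?thesis
          using ij v[of j i] v[of "b + 1 - i" "b + 1 - j"] by (intro mult_nonpos_nonneg) auto
      qed
    qed simp
    finally show "disassortative_mixing (gcm_edge_pmf b q p H h)"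
      by (simp add: disassortative_mixing_def)
  }
qed

end
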